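(* For any Latin square $L$ of order $n$, $d_3(L_3(L,n))\leq n$, and equality holds if and only if $\tau(L)=n$.
   Context: A Latin square of order $n$ is an $n\times n$ array $L=(\ell_{i,j})$ with entries from $[n]$ such that no symbol appears twice in any row or column. A transversal in $L$ is a set of cells containing exactly one cell from each row, one from each column, and one cell of each symbol; $\tau(L)$ is the maximum number of pairwise disjoint transversals in $L$. The Latin square graph $L_3(L,n)$ has vertex set $\{(i,j)\mid 1\le i,j\le n\}$, with distinct $(i,j),(p,q)$ adjacent iff $i=p$ or $j=q$ or $\ell_{i,j}=\ell_{p,q}$. A set $S$ of vertices of a graph $G$ is $3$-dominating if every vertex outside $S$ has at least $3$ neighbours in $S$; the $3$-domatic number $d_3(G)$ is the maximum number of sets in a partition of $V(G)$ into $3$-dominating sets. *)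

theory Defs
  imports "Graph_Theory.Pair_Digraph" "HOL-Library.Disjoint_Sets"
begin

definition latin_square :: "nat \<Rightarrow> (nat \<Rightarrow> nat \<Rightarrow> nat) \<Rightarrow> bool" where
  "latin_square n L \<longleftrightarrow>
     (\<forall>i\<in>{1..n}. \<forall>j\<in>{1..n}. L i j \<in> {1..n}) \<and>
     (\<forall>i\<in>{1..n}. inj_on (\<lambda>j. L i j) {1..n}) \<and>
     (\<forall>j\<in>{1..n}. inj_on (\<lambda>i. L i j) {1..n})"

definition cells :: "nat \<Rightarrow> (nat \<times> nat) set" where
  "cells n = {1..n} \<times> {1..n}"

definition transversal :: "nat \<Rightarrow> (nat \<Rightarrow> nat \<Rightarrow> nat) \<Rightarrow> (nat \<times> nat) set \<Rightarrow> bool" where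
  "transversal n L T \<longleftrightarrow>
     T \<subseteq> cells n \<and>
     (\<forall>i\<in>{1..n}. \<exists>!c. c \<in> T \<and> fst c = i) \<and>
     (\<forall>j\<in>{1..n}. \<exists>!c. c \<in> T \<and> snd c = j) \<and>
     (\<forall>k\<in>{1..n}. \<exists>!c. c \<in> T \<and> L (fst c) (snd c) = k)"

text \<open>The set under the maximum is finite, since a family of transversals is a subset of
  \<^term>\<open>Pow (cells n)\<close>, and it contains 0, the size of the empty family.\<close>

definition max_disjoint_transversals :: "nat \<Rightarrow> (nat \<Rightarrow> nat \<Rightarrow> nat) \<Rightarrow> nat" where
  "max_disjoint_transversals n L =
     Max {card F | F. (\<forall>T\<in>F. transversal n L T) \<and> disjoint F}"

text \<open>An undirected simple graph is a \<^locale>\<open>pair_graph\<close>: an edge is represented by its two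
  opposite arcs.\<close>

definition latin_square_graph :: "nat \<Rightarrow> (nat \<Rightarrow> nat \<Rightarrow> nat) \<Rightarrow> (nat \<times> nat) pair_pre_digraph" where
  "latin_square_graph n L =
     \<lparr> pverts = cells n,
       parcs = {((i, j), (p, q)) | i j p q.
          (i, j) \<in> cells n \<and> (p, q) \<in> cells n \<and> (i, j) \<noteq> (p, q) \<and>
          (i = p \<or> j = q \<or> L i j = L p q)} \<rparr>"

lemma pair_graph_latin_square_graph: "pair_graph (latin_square_graph n L)"
proof
  show "finite (pverts (latin_square_graph n L))"
    by (simp add: latin_square_graph_def cells_def)
  show "finite (parcs (latin_square_graph n L))"
    by (rule finite_subset[of _ "cells n \<times> cells n"])
       (auto simp: latin_square_graph_def cells_def)
qed (auto simp: latin_square_graph_def arcs_ends_def symmetric_def arc_to_ends_def intro!: symI)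

definition k_dominating :: "nat \<Rightarrow> 'a pair_pre_digraph \<Rightarrow> 'a set \<Rightarrow> bool" where
  "k_dominating k G S \<longleftrightarrow>
     S \<subseteq> pverts G \<and> (\<forall>v \<in> pverts G - S. k \<le> card {u \<in> S. (v, u) \<in> parcs G})"

text \<open>Meant for finite graphs with at least one vertex: then the one-part partition
  \<^term>\<open>{pverts G}\<close> shows that the set under the maximum is nonempty.\<close>

definition k_domatic_number :: "nat \<Rightarrow> 'a pair_pre_digraph \<Rightarrow> nat" where
  "k_domatic_number k G =
     Max {card P | P. partition_on (pverts G) P \<and> (\<forall>S\<in>P. k_dominating k G S)}"

end

theory Submission
  imports Defs
begin

text \<open>
  Write \<open>r\<close>, \<open>c\<close>, \<open>s\<close> for the numbers of cells of a set \<open>S\<close> in the row, in the column and with the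
  symbol of a given cell. A cell outside \<open>S\<close> has exactly \<open>r + c + s\<close> neighbours in \<open>S\<close>, and a cell
  of \<open>S\<close> has \<open>r, c, s \<ge> 1\<close>; so if \<open>S\<close> is 3-dominating, then \<open>r + c + s \<ge> 3\<close> at every cell. Summing
  over all cells gives \<open>3 n |S| \<ge> 3 n\<^sup>2\<close>, that is \<open>|S| \<ge> n\<close>. If \<open>|S| = n\<close>, then \<open>r + c + s = 3\<close> at
  every cell, hence \<open>r = c = s = 1\<close> on \<open>S\<close>, and \<open>S\<close> is a transversal. Since there are \<open>n\<^sup>2\<close> cells, a
  partition into 3-dominating sets has at most \<open>n\<close> parts, with equality only if all are transversals.
\<close>

section \<open>Fibres of a map: double counting and bijections\<close>

text \<open>Both sides count the pairs \<open>(v, u)\<close> in \<open>A \<times> S\<close> with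
  \<open>g u = g v\<close>, once by \<open>v\<close> and once by \<open>u\<close>. It is applied
  with \<open>g\<close> giving the row, the column and the symbol of a cell.\<close>

lemma sum_card_fibres:
  assumes "finite A" and "finite S" and "\<And>u. u \<in> S \<Longrightarrow> card {v \<in> A. g v = g u} = n"
  shows "(\<Sum>v\<in>A. card {u \<in> S. g u = g v}) = n * card S"
proof -
  have "(\<Sum>v\<in>A. card {u \<in> S. g u = g v}) = (\<Sum>v\<in>A. \<Sum>u\<in>S. if g u = g v then 1 else 0)"
    by (simp add: assms(2) sum.If_cases Int_def)
  also have "\<dots> = (\<Sum>u\<in>S. \<Sum>v\<in>A. if g u = g v then 1 else 0)"
    by (rule sum.swap)
  also have "\<dots> = (\<Sum>u\<in>S. card {v \<in> A. g v = g u})"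
    by (simp add: assms(1) sum.If_cases Int_def eq_commute)
  also have "\<dots> = n * card S"
    by (simp add: assms(3))
  finally show ?thesis .
qed

lemma inj_on_card_fibre_le_1:
  assumes "finite S" and "\<And>v. v \<in> S \<Longrightarrow> card {u \<in> S. g u = g v} \<le> 1"
  shows "inj_on g S"
proof (rule inj_onI)
  fix x y assume xy: "x \<in> S" "y \<in> S" "g x = g y"
  have "finite {u \<in> S. g u = g y}"
    using assms(1) by simp
  then show "x = y"
    using assms(2)[OF xy(2)] xy by (auto simp: card_le_Suc0_iff_eq)
qed

lemma card_fibre_eq_1:
  assumes "bij_betw g T B" and "b \<in> B"
  shows "card {u \<in> T. g u = b} = 1"
proof -
  obtain t where "t \<in> T" "g t = b"
    using assms by (auto simp: bij_betw_def)
  with assms(1) have "{u \<in> T. g u = b} = {t}"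
    by (auto simp: bij_betw_def inj_on_def)
  then show ?thesis by simp
qed

text \<open>Turns the "exactly one cell" clauses of \<open>transversal\<close> into bijections, from
  which cardinalities can be read off.\<close>

lemma bij_betw_iff_ex1:
  assumes "g ` T \<subseteq> B"
  shows "bij_betw g T B \<longleftrightarrow> (\<forall>b\<in>B. \<exists>!c. c \<in> T \<and> g c = b)"
proof
  assume "bij_betw g T B"
  then show "\<forall>b\<in>B. \<exists>!c. c \<in> T \<and> g c = b"
    by (auto simp: bij_betw_def inj_on_def)
next
  assume ex1: "\<forall>b\<in>B. \<exists>!c. c \<in> T \<and> g c = b"
  have "inj_on g T"
  proof (rule inj_onI)
    fix x y assume xy: "x \<in> T" "y \<in> T" "g x = g y"
    with assms have "\<exists>!c. c \<in> T \<and> g c = g x"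
      by (intro bspec[OF ex1]) auto
    with xy show "x = y"
      by metis
  qed
  moreover have "B \<subseteq> g ` T"
    using ex1 by (metis image_eqI subsetI)
  ultimately show "bij_betw g T B"
    using assms by (simp add: bij_betw_def subset_antisym)
qed

section \<open>Rows, columns and symbols of a Latin square\<close>

lemma finite_cells [simp]: "finite (cells n)"
  and card_cells: "card (cells n) = n * n"
  by (simp_all add: cells_def)

abbreviation symbol :: "(nat \<Rightarrow> nat \<Rightarrow> nat) \<Rightarrow> nat \<times> nat \<Rightarrow> nat" where
  "symbol L c \<equiv> L (fst c) (snd c)"

text \<open>Injectivity along the common row or column. Hence distinct cells with the same symbol
  share neither.\<close>

lemma symbol_inj:
  assumes "latin_square n L" and "u \<in> cells n" and "v \<in> cells n" and "symbol L u = symbol L v"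
  shows "fst u = fst v \<longleftrightarrow> snd u = snd v"
proof -
  have mem: "fst u \<in> {1..n}" "snd u \<in> {1..n}" "fst v \<in> {1..n}" "snd v \<in> {1..n}"
    using assms(2,3) by (auto simp: cells_def)
  have "inj_on (\<lambda>j. L (fst v) j) {1..n}" "inj_on (\<lambda>i. L i (snd v)) {1..n}"
    using assms(1) mem unfolding latin_square_def by blast+
  with mem assms(4) show ?thesis
    by (metis inj_onD)
qed

lemma transversal_iff_bij_betw:
  assumes "latin_square n L"
  shows "transversal n L T \<longleftrightarrow> T \<subseteq> cells n \<and> bij_betw fst T {1..n} \<and> bij_betw snd T {1..n} \<and>
    bij_betw (symbol L) T {1..n}"
proof (cases "T \<subseteq> cells n")
  case True
  then have "fst ` T \<subseteq> {1..n}" "snd ` T \<subseteq> {1..n}" "symbol L ` T \<subseteq> {1..n}"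
    using assms by (auto simp: cells_def latin_square_def)
  with True show ?thesis
    by (simp only: transversal_def bij_betw_iff_ex1 simp_thms)
next
  case False
  then show ?thesis
    by (simp add: transversal_def)
qed

lemma card_transversal:
  assumes "latin_square n L" and "transversal n L T"
  shows "card T = n"
proof -
  have "bij_betw fst T {1..n}"
    using assms(2) transversal_iff_bij_betw[OF assms(1)] by blast
  then show ?thesis
    using bij_betw_same_card by fastforce
qed

lemma card_fibre_cells:
  assumes L: "latin_square n L" and u: "u \<in> cells n"
  shows "card {v \<in> cells n. fst v = fst u} = n"
    and "card {v \<in> cells n. snd v = snd u} = n"
    and "card {v \<in> cells n. symbol L v = symbol L u} = n"
proof -
  have "{v \<in> cells n. fst v = fst u} = {fst u} \<times> {1..n}"
    "{v \<in> cells n. snd v = snd u} = {1..n} \<times> {snd u}"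
    using u by (auto simp: cells_def)
  then show "card {v \<in> cells n. fst v = fst u} = n" "card {v \<in> cells n. snd v = snd u} = n"
    by (simp_all add: card_cartesian_product)
  let ?F = "{v \<in> cells n. symbol L v = symbol L u}"
  \<comment> \<open>Row \<open>i\<close> is an injective map of \<open>{1..n}\<close> into itself,
    hence onto, so every symbol occurs in it. With \<open>symbol_inj\<close>, \<open>fst\<close>
    maps the cells of one symbol bijectively onto the rows.\<close>
  have "i \<in> fst ` ?F" if i: "i \<in> {1..n}" for i
  proof -
    have "(\<lambda>j. L i j) ` {1..n} = {1..n}"
      using L i by (intro endo_inj_surj) (auto simp: latin_square_def)
    moreover have "symbol L u \<in> {1..n}"
      using L u by (auto simp: latin_square_def cells_def)
    ultimately obtain j where "j \<in> {1..n}" "L i j = symbol L u"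
      by (metis imageE)
    with i show ?thesis
      by (intro image_eqI[of _ _ "(i, j)"]) (auto simp: cells_def)
  qed
  then have "fst ` ?F = {1..n}"
    by (auto simp: cells_def)
  moreover have "inj_on fst ?F"
    using symbol_inj[OF L] by (auto simp: inj_on_def prod_eq_iff)
  ultimately show "card ?F = n"
    using card_image[of fst ?F] by simp
qed

text \<open>A cell that agrees with \<open>v\<close> in two of row, column and symbol is
  \<open>v\<close> itself. Since \<open>v\<close> is not in \<open>S\<close>, the three kinds of
  neighbours are disjoint and their numbers add up.\<close>

lemma card_neighbours:
  assumes L: "latin_square n L" and S: "S \<subseteq> cells n" and v: "v \<in> cells n - S"
  shows "card {u \<in> S. (v, u) \<in> parcs (latin_square_graph n L)} =
    card {u \<in> S. fst u = fst v} + card {u \<in> S. snd u = snd v} +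
    card {u \<in> S. symbol L u = symbol L v}"
proof -
  let ?R = "{u \<in> S. fst u = fst v}" and ?C = "{u \<in> S. snd u = snd v}"
    and ?K = "{u \<in> S. symbol L u = symbol L v}"
  have fin: "finite S"
    using S finite_cells by (rule finite_subset)
  have "{u \<in> S. (v, u) \<in> parcs (latin_square_graph n L)} = (?R \<union> ?C) \<union> ?K"
    using S v by (cases v) (auto simp: latin_square_graph_def)
  moreover have "?R \<inter> ?C = {}"
    using v by (auto simp: prod_eq_iff)
  moreover have "(?R \<union> ?C) \<inter> ?K = {}"
    using S v symbol_inj[OF L] by (fastforce simp: prod_eq_iff)
  ultimately show ?thesis
    using fin by (simp add: card_Un_disjoint)
qed

section \<open>Size of a 3-dominating set\<close>

context
  fixes n :: nat and L :: "nat \<Rightarrow> nat \<Rightarrow> nat" and S :: "(nat \<times> nat) set"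
  assumes L: "latin_square n L" and dom: "k_dominating 3 (latin_square_graph n L) S"
begin

lemma dominating_subset_cells: "S \<subseteq> cells n"
  using dom by (simp add: k_dominating_def latin_square_graph_def)

lemma dominating_finite: "finite S"
  using dominating_subset_cells finite_cells by (rule finite_subset)

lemma dominating_line_count_ge_1:
  assumes "v \<in> S"
  shows "1 \<le> card {u \<in> S. g u = g v}"
proof -
  have "card {v} \<le> card {u \<in> S. g u = g v}"
    using assms dominating_finite by (intro card_mono) auto
  then show ?thesis by simp
qed

lemma dominating_line_count_ge_3:
  assumes v: "v \<in> cells n"
  shows "3 \<le> card {u \<in> S. fst u = fst v} + card {u \<in> S. snd u = snd v} +
    card {u \<in> S. symbol L u = symbol L v}"
proof (cases "v \<in> S")
  case True
  show ?thesis
    using dominating_line_count_ge_1[OF True, of fst] dominating_line_count_ge_1[OF True, of snd]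
      dominating_line_count_ge_1[OF True, of "symbol L"] by linarith
next
  case False
  then have "3 \<le> card {u \<in> S. (v, u) \<in> parcs (latin_square_graph n L)}"
    using dom v by (auto simp: k_dominating_def latin_square_graph_def)
  then show ?thesis
    using card_neighbours[OF L dominating_subset_cells, of v] v False by simp
qed

lemma dominating_line_count_sum:
  "(\<Sum>v\<in>cells n. card {u \<in> S. fst u = fst v} + card {u \<in> S. snd u = snd v} +
    card {u \<in> S. symbol L u = symbol L v}) = 3 * (n * card S)"
proof -
  have sub: "u \<in> cells n" if "u \<in> S" for u
    using that dominating_subset_cells by auto
  show ?thesis
    using sum_card_fibres[OF finite_cells dominating_finite card_fibre_cells(1)[OF L sub]]
      sum_card_fibres[OF finite_cells dominating_finite card_fibre_cells(2)[OF L sub]]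
      sum_card_fibres[OF finite_cells dominating_finite card_fibre_cells(3)[OF L sub]]
    by (simp add: sum.distrib)
qed

lemma card_dominating_ge: "n \<le> card S"
proof -
  have "(\<Sum>v\<in>cells n. 3) \<le> (\<Sum>v\<in>cells n. card {u \<in> S. fst u = fst v} +
    card {u \<in> S. snd u = snd v} + card {u \<in> S. symbol L u = symbol L v})"
    by (intro sum_mono dominating_line_count_ge_3)
  then have "n * n \<le> n * card S"
    unfolding dominating_line_count_sum by (simp add: card_cells)
  then show ?thesis
    by (cases "n = 0") auto
qed

lemma dominating_card_eq_transversal:
  assumes card: "card S = n"
  shows "transversal n L S"
proof -
  have eq: "3 = card {u \<in> S. fst u = fst v} + card {u \<in> S. snd u = snd v} +
    card {u \<in> S. symbol L u = symbol L v}" if "v \<in> cells n" for v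
  \<comment> \<open>Every term is at least 3 and the total is \<open>3 * (n * n)\<close>, so no term
    can exceed 3.\<close>
  proof (rule sum_mono_inv[OF _ dominating_line_count_ge_3 that finite_cells])
    show "(\<Sum>v\<in>cells n. 3) = (\<Sum>v\<in>cells n. card {u \<in> S. fst u = fst v} +
      card {u \<in> S. snd u = snd v} + card {u \<in> S. symbol L u = symbol L v})"
      unfolding dominating_line_count_sum by (simp add: card card_cells)
  qed
  have le: "card {u \<in> S. fst u = fst v} \<le> 1" "card {u \<in> S. snd u = snd v} \<le> 1"
    "card {u \<in> S. symbol L u = symbol L v} \<le> 1" if "v \<in> S" for v
    using eq[of v] dominating_subset_cells dominating_line_count_ge_1[OF that, of fst]
      dominating_line_count_ge_1[OF that, of snd]
      dominating_line_count_ge_1[OF that, of "symbol L"] that by auto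
  \<comment> \<open>An injective image of \<open>S\<close> in \<open>{1..n}\<close> has
    \<open>n\<close> elements, so it is everything.\<close>
  have bij: "bij_betw g S {1..n}" if "inj_on g S" "g ` S \<subseteq> {1..n}" for g :: "nat \<times> nat \<Rightarrow> nat"
    using that card card_subset_eq[of "{1..n}" "g ` S"] by (simp add: bij_betw_def card_image)
  have "fst ` S \<subseteq> {1..n}" "snd ` S \<subseteq> {1..n}" "symbol L ` S \<subseteq> {1..n}"
    using L dominating_subset_cells by (auto simp: cells_def latin_square_def)
  then show ?thesis
    unfolding transversal_iff_bij_betw[OF L]
    by (intro conjI bij inj_on_card_fibre_le_1 dominating_subset_cells dominating_finite le)
qed

end

text \<open>A cell outside \<open>T\<close> meets \<open>T\<close> exactly once in its row, once in
  its column and once in its symbol, which makes exactly 3 neighbours.\<close>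

lemma transversal_dominating:
  assumes L: "latin_square n L" and T: "transversal n L T"
  shows "k_dominating 3 (latin_square_graph n L) T"
  unfolding k_dominating_def
proof (intro conjI ballI)
  have sub: "T \<subseteq> cells n" and bij: "bij_betw fst T {1..n}" "bij_betw snd T {1..n}"
    "bij_betw (symbol L) T {1..n}"
    using T by (auto simp: transversal_iff_bij_betw[OF L])
  show "T \<subseteq> pverts (latin_square_graph n L)"
    using sub by (simp add: latin_square_graph_def)
  fix v assume "v \<in> pverts (latin_square_graph n L) - T"
  then have v: "v \<in> cells n - T"
    by (simp add: latin_square_graph_def)
  then have "fst v \<in> {1..n}" "snd v \<in> {1..n}" "symbol L v \<in> {1..n}"
    using L by (auto simp: cells_def latin_square_def)
  then show "3 \<le> card {u \<in> T. (v, u) \<in> parcs (latin_square_graph n L)}"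
    unfolding card_neighbours[OF L sub v] using bij by (simp add: card_fibre_eq_1)
qed

section \<open>Counting parts and disjoint transversals\<close>

text \<open>The sizes of the parts add up to \<open>n * n\<close> and each is at least
  \<open>n\<close>; with \<open>n\<close> parts there is no slack left.\<close>

lemma card_partition_on_bound:
  assumes A: "finite A" "card A = n * n" and P: "partition_on A P"
    and ge: "\<And>S. S \<in> P \<Longrightarrow> n \<le> card S" and n: "1 \<le> n"
  shows "card P \<le> n" and "card P = n \<Longrightarrow> S \<in> P \<Longrightarrow> card S = n"
proof -
  have fin: "finite P"
    using A(1) P by (rule finite_elements)
  have sum: "sum card P = n * n"
    using product_partition[OF P] A(2) finite_subset[OF _ A(1)] partition_onD1[OF P]
    by (metis Union_upper)
  have "card P * n \<le> n * n"
    using sum_bounded_below[of P n card] ge sum by simp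
  then show "card P \<le> n"
    using n by simp
  assume "card P = n" "S \<in> P"
  then show "card S = n"
    using sum_mono_inv[of "\<lambda>_. n" P card S] ge sum fin by simp
qed

text \<open>Each transversal has \<open>n\<close> cells, so disjoint ones number at most
  \<open>n\<close>, and \<open>n\<close> of them use up all \<open>n * n\<close> cells.\<close>

lemma disjoint_transversals_partition_on:
  assumes n: "1 \<le> n" and L: "latin_square n L"
    and F: "\<forall>T\<in>F. transversal n L T" "disjoint F"
  shows "card F \<le> n" and "card F = n \<Longrightarrow> partition_on (cells n) F"
proof -
  have card: "card T = n" if "T \<in> F" for T
    using that F(1) card_transversal[OF L] by blast
  have sub: "\<Union>F \<subseteq> cells n"
    using F(1) by (auto simp: transversal_def)
  have "finite T" if "T \<in> F" for T
    using that F(1) finite_subset[OF _ finite_cells] by (auto simp: transversal_def)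
  then have "card (\<Union>F) = sum card F"
    using F(2) by (intro card_Union_disjoint)
  then have "card (\<Union>F) = card F * n"
    by (simp add: card)
  moreover have "card (\<Union>F) \<le> n * n"
    using card_mono[OF finite_cells sub] by (simp add: card_cells)
  ultimately show "card F \<le> n"
    using n by simp
  assume "card F = n"
  then have "\<Union>F = cells n"
    using \<open>card (\<Union>F) = card F * n\<close> sub by (intro card_subset_eq) (auto simp: card_cells)
  moreover have "{} \<notin> F"
    using card n by fastforce
  ultimately show "partition_on (cells n) F"
    using F(2) by (simp add: partition_on_def)
qed

text \<open>The bound makes \<open>A\<close> finite, so \<open>Max A\<close> is attained. Whether a
  maximum reaches its bound thus becomes a question of membership.\<close>

lemma Max_eq_bound_iff:
  fixes n :: nat
  assumes "\<And>x. x \<in> A \<Longrightarrow> x \<le> n" and "A \<noteq> {}"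
  shows "Max A \<le> n \<and> (Max A = n \<longleftrightarrow> n \<in> A)"
proof -
  have "finite A"
    using assms(1) by (intro finite_subset[of A "{..n}"]) auto
  then show ?thesis
    using assms Max_in[of A] Max_eqI[of A n] by metis
qed

theorem theorem2p3:
  fixes n :: nat and L :: "nat \<Rightarrow> nat \<Rightarrow> nat"
  assumes "1 \<le> n"
    and "latin_square n L"
  shows "k_domatic_number 3 (latin_square_graph n L) \<le> n \<and>
    (k_domatic_number 3 (latin_square_graph n L) = n \<longleftrightarrow> max_disjoint_transversals n L = n)"
proof -
  note n = assms(1) and L = assms(2)
  let ?G = "latin_square_graph n L"
  let ?D = "\<lambda>P. partition_on (cells n) P \<and> (\<forall>S\<in>P. k_dominating 3 ?G S)"
  let ?T = "\<lambda>F. (\<forall>T\<in>F. transversal n L T) \<and> disjoint F"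
  have verts: "pverts ?G = cells n"
    by (simp add: latin_square_graph_def)
  have D: "card P \<le> n" "card P = n \<Longrightarrow> S \<in> P \<Longrightarrow> card S = n" if "?D P" for P S
    using that card_partition_on_bound[OF finite_cells card_cells, of n P] card_dominating_ge[OF L] n
    by blast+
  have "cells n \<noteq> {}"
    using n by (auto simp: cells_def)
  \<comment> \<open>The one-part partition makes the set of sizes nonempty; it dominates
    vacuously.\<close>
  then have "?D {cells n}"
    by (simp add: partition_on_space k_dominating_def verts)
  then have dom: "k_domatic_number 3 ?G \<le> n \<and> (k_domatic_number 3 ?G = n \<longleftrightarrow> n \<in> {card P |P. ?D P})"
    unfolding k_domatic_number_def verts by (intro Max_eq_bound_iff) (use D(1) in blast)+
  have "?T {}"
    by simp
  then have tau: "max_disjoint_transversals n L = n \<longleftrightarrow> n \<in> {card F |F. ?T F}"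
    unfolding max_disjoint_transversals_def
    by (intro conjunct2[OF Max_eq_bound_iff])
      (use disjoint_transversals_partition_on(1)[OF n L] in blast)+
  \<comment> \<open>At size \<open>n\<close> the two kinds of families are the same, so one family
    witnesses both maxima.\<close>
  have "?T P" if "?D P" "card P = n" for P
    using that D(2)[OF that(1)] dominating_card_eq_transversal[OF L] partition_onD2 by blast
  moreover have "?D F" if "?T F" "card F = n" for F
    using that disjoint_transversals_partition_on(2)[OF n L] transversal_dominating[OF L] by blast
  ultimately have "n \<in> {card P |P. ?D P} \<longleftrightarrow> n \<in> {card F |F. ?T F}"
    by blast
  with dom tau show ?thesis
    by blast
qed

end
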